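(* Let $K$ be a compact Hausdorff space, $\varphi\colon K\to K$ a continuous map, and $T_\varphi$ the Koopman operator on $\mathrm{C}(K)$. Then the decomposition of $K$ induced by $\operatorname{fix}T_\varphi$, i.e. the partition of $K$ into the maximal level sets of $\operatorname{fix}T_\varphi$, is the finest decomposition of $K$ into absolutely Lyapunov stable sets. That is: every maximal level set of $\operatorname{fix}T_\varphi$ is absolutely Lyapunov stable, and for every partition $\mathcal{P}$ of $K$ into absolutely Lyapunov stable sets, each maximal level set of $\operatorname{fix}T_\varphi$ is contained in some member of $\mathcal{P}$.
   Context: $\mathrm{C}(K)$ is the $C^*$-algebra of continuous complex-valued functions on $K$; $T_\varphi f:=f\circ\varphi$ for $f\in\mathrm{C}(K)$, and $\operatorname{fix}T_\varphi:=\{f\in\mathrm{C}(K): T_\varphi f=f\}$. A nonempty set $M\subseteq K$ is a level set of $\operatorname{fix}T_\varphi$ if $f|_M$ is constant for all $f\in\operatorname{fix}T_\varphi$; it is maximal if it is not properly contained in another level set. The maximal level sets form a partition of $K$; $x,y$ lie in the same one iff $f(x)=f(y)$ for all $f\in\operatorname{fix}T_\varphi$. A decomposition (partition) of $K$ is a family of pairwise disjoint nonempty subsets with union $K$. $\mathcal{U}(x)$ denotes the neighborhood filter of $x$ (neighborhoods need not be open), and $\mathcal{U}(M)$ the set of neighborhoods of a set $M\subseteq K$ (sets whose interior contains $M$). For a family $(K_x)_{x\in K}$ of subsets of $K$ with $x\in K_x$ for all $x$, the equivalence relation generated by $(K_x)_{x\in K}$ is: $x\sim y$ iff there are $k\in\mathbb{N}$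 and $x_1,\dots,x_k\in K$ with $x_1=x$, $x_k=y$ and $K_{x_i}\cap K_{x_{i+1}}\neq\emptyset$ for $i=1,\dots,k-1$. For every ordinal $\gamma$ and $x\in K$ define by transfinite recursion $\operatorname{aorb}_\gamma(x)\subseteq K$, the equivalence relation $\sim_\gamma$ on $K$ and the superorbit $\operatorname{sorb}_\gamma(x)\subseteq K$ as follows. Write $\operatorname{sorb}_\beta(S):=\bigcup_{y\in S}\operatorname{sorb}_\beta(y)$ for $S\subseteq K$ and define the $\operatorname{sorb}_\beta$-closure of $U\subseteq K$ by $\overline{U}^{\operatorname{sorb}_\beta}:=\bigcap\{F: F\subseteq K\text{ closed},\ U\subseteq F,\ \operatorname{sorb}_\beta(F)\subseteq F\}$. Base case: $\operatorname{aorb}_0(x):=\bigcap\{U: U\in\mathcal{U}(x)\text{ closed},\ \varphi(U)\subseteq U\}$. Successor case $\gamma=\beta+1$: $\operatorname{aorb}_{\gamma}(x):=\bigcap\{\overline{U}^{\operatorname{sorb}_{\beta}}: U\in\mathcal{U}(x)\text{ open},\ \operatorname{sorb}_{\beta}(U)\subseteq U\}$. Limit case ($\gamma\neq0$ a limit ordinal): $\operatorname{aorb}_\gamma(x):=\bigcup_{\beta<\gamma}\operatorname{sorb}_\beta(x)$. In all cases $\sim_\gamma$ is the equivalence relation generated by $(\operatorname{aorb}_\gamma(x))_{x\in K}$, and $\operatorname{sorb}_\gamma(x):=\bigcup_{y\sim_\gamma x}\operatorname{aorb}_\gamma(y)$, which is the $\sim_\gamma$-equivalence class of $x$ as a subset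 of $K$. A set $M\subseteq K$ is Lyapunov stable of degree $\alpha$ ($\alpha$ an ordinal) if $M=\bigcap\{\overline{U}^{\operatorname{sorb}_\alpha}: U\in\mathcal{U}(M)\text{ open},\ \operatorname{sorb}_\alpha(U)\subseteq U\}$. $M$ is absolutely Lyapunov stable if it is Lyapunov stable of degree $\alpha$ for all ordinals $\alpha$. *)

theory Defs
  imports "HOL-Analysis.Analysis"
begin

section \<open>Fixed functions of the Koopman operator and their level sets\<close>

text \<open>
  The space \<open>K\<close> is \<^term>\<open>topspace X\<close> for a topology \<open>X\<close>.  Functions on \<open>K\<close> are
  represented by functions that take the value \<^term>\<open>undefined\<close> outside \<open>K\<close>, so that
  equality in \<open>C(K)\<close> is equality in HOL.
\<close>

definition cont_fun :: "'a topology \<Rightarrow> ('a \<Rightarrow> complex) set" where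
  "cont_fun X = {f \<in> extensional (topspace X). continuous_map X euclidean f}"

definition koopman :: "'a topology \<Rightarrow> ('a \<Rightarrow> 'a) \<Rightarrow> ('a \<Rightarrow> complex) \<Rightarrow> ('a \<Rightarrow> complex)" where
  "koopman X \<phi> f = restrict (f \<circ> \<phi>) (topspace X)"

definition fix_koopman :: "'a topology \<Rightarrow> ('a \<Rightarrow> 'a) \<Rightarrow> ('a \<Rightarrow> complex) set" where
  "fix_koopman X \<phi> = {f \<in> cont_fun X. koopman X \<phi> f = f}"

definition level_set :: "'a topology \<Rightarrow> ('a \<Rightarrow> complex) set \<Rightarrow> 'a set \<Rightarrow> bool" where
  "level_set X F M \<longleftrightarrow> M \<noteq> {} \<and> M \<subseteq> topspace X \<and> (\<forall>f\<in>F. f constant_on M)"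

definition maximal_level_set :: "'a topology \<Rightarrow> ('a \<Rightarrow> complex) set \<Rightarrow> 'a set \<Rightarrow> bool" where
  "maximal_level_set X F M \<longleftrightarrow> level_set X F M \<and> \<not> (\<exists>N. level_set X F N \<and> M \<subset> N)"


section \<open>The hierarchy of superorbits\<close>

definition nhds_of :: "'a topology \<Rightarrow> 'a set \<Rightarrow> 'a set set" where
  "nhds_of X M = {U. U \<subseteq> topspace X \<and> M \<subseteq> X interior_of U}"

definition gen_equiv :: "'a set \<Rightarrow> ('a \<Rightarrow> 'a set) \<Rightarrow> 'a \<Rightarrow> 'a \<Rightarrow> bool" where
  "gen_equiv K A x y \<longleftrightarrow>
     (\<exists>(k::nat) z. 1 \<le> k \<and> (\<forall>i\<in>{1..k}. z i \<in> K) \<and> z 1 = x \<and> z k = y \<and>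
        (\<forall>i\<in>{1..<k}. A (z i) \<inter> A (z (Suc i)) \<noteq> {}))"

text \<open>The step from \<open>aorb\<^sub>\<gamma>\<close> to \<open>sorb\<^sub>\<gamma>\<close>, the same for all \<open>\<gamma>\<close>.\<close>

definition sorb_of :: "'a set \<Rightarrow> ('a \<Rightarrow> 'a set) \<Rightarrow> 'a \<Rightarrow> 'a set" where
  "sorb_of K A x = (\<Union>y\<in>{y. gen_equiv K A y x}. A y)"

text \<open>In the next three definitions \<open>s\<close> stands for \<open>sorb\<^sub>\<beta>\<close>.\<close>

definition orb_closure :: "'a topology \<Rightarrow> ('a \<Rightarrow> 'a set) \<Rightarrow> 'a set \<Rightarrow> 'a set" where
  "orb_closure X s U = \<Inter>{F. closedin X F \<and> U \<subseteq> F \<and> (\<Union>y\<in>F. s y) \<subseteq> F}"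

definition inv_open_nhds :: "'a topology \<Rightarrow> ('a \<Rightarrow> 'a set) \<Rightarrow> 'a set \<Rightarrow> 'a set set" where
  "inv_open_nhds X s M = {U \<in> nhds_of X M. openin X U \<and> (\<Union>y\<in>U. s y) \<subseteq> U}"

definition aorb_Suc :: "'a topology \<Rightarrow> ('a \<Rightarrow> 'a set) \<Rightarrow> 'a \<Rightarrow> 'a set" where
  "aorb_Suc X s x = \<Inter>{orb_closure X s U |U. U \<in> inv_open_nhds X s {x}}"

definition aorb_0 :: "'a topology \<Rightarrow> ('a \<Rightarrow> 'a) \<Rightarrow> 'a \<Rightarrow> 'a set" where
  "aorb_0 X \<phi> x = \<Inter>{U \<in> nhds_of X {x}. closedin X U \<and> \<phi> ` U \<subseteq> U}"

text \<open>
  The index \<open>\<gamma>\<close> ranges over an arbitrary well-ordered type; it stands for the ordinal that is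
  the order type of \<^term>\<open>{..<\<gamma>}\<close>.  Every ordinal occurs in some such type.
\<close>

definition is_zero_ord :: "'o::wellorder \<Rightarrow> bool" where
  "is_zero_ord \<gamma> \<longleftrightarrow> (\<forall>\<beta>. \<gamma> \<le> \<beta>)"

definition is_succ_of :: "'o::wellorder \<Rightarrow> 'o \<Rightarrow> bool" where
  "is_succ_of \<gamma> \<beta> \<longleftrightarrow> \<beta> < \<gamma> \<and> \<not> (\<exists>\<delta>. \<beta> < \<delta> \<and> \<delta> < \<gamma>)"

lemma is_succ_of_unique: "is_succ_of \<gamma> \<beta> \<Longrightarrow> is_succ_of \<gamma> \<beta>' \<Longrightarrow> \<beta> = \<beta>'"
  unfolding is_succ_of_def by (metis linorder_neqE)

lemma the_is_succ_of: "is_succ_of \<gamma> \<beta> \<Longrightarrow> (THE \<beta>. is_succ_of \<gamma> \<beta>) = \<beta>"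
  using is_succ_of_unique by blast

function aorb :: "'a topology \<Rightarrow> ('a \<Rightarrow> 'a) \<Rightarrow> 'o::wellorder \<Rightarrow> 'a \<Rightarrow> 'a set" where
  "aorb X \<phi> \<gamma> =
     (if is_zero_ord \<gamma> then aorb_0 X \<phi>
      else if \<exists>\<beta>. is_succ_of \<gamma> \<beta>
      then aorb_Suc X (sorb_of (topspace X) (aorb X \<phi> (THE \<beta>. is_succ_of \<gamma> \<beta>)))
      else (\<lambda>x. \<Union>\<beta>\<in>{..<\<gamma>}. sorb_of (topspace X) (aorb X \<phi> \<beta>) x))"
  by pat_completeness auto
termination
proof (relation "inv_image {(a, b). a < b} (\<lambda>(X, \<phi>, \<gamma>). \<gamma>)")
  show "wf (inv_image {(a, b). a < b} (\<lambda>(X::'a topology, \<phi>::'a \<Rightarrow> 'a, \<gamma>::'o::wellorder). \<gamma>))"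
    by (intro wf_inv_image wf)
qed (auto simp: the_is_succ_of, auto simp: is_succ_of_def)

declare aorb.simps [simp del]

definition sorb :: "'a topology \<Rightarrow> ('a \<Rightarrow> 'a) \<Rightarrow> 'o::wellorder \<Rightarrow> 'a \<Rightarrow> 'a set" where
  "sorb X \<phi> \<gamma> = sorb_of (topspace X) (aorb X \<phi> \<gamma>)"

lemma aorb_zero: "is_zero_ord \<gamma> \<Longrightarrow> aorb X \<phi> \<gamma> = aorb_0 X \<phi>"
  by (subst aorb.simps) simp

lemma aorb_succ:
  assumes "is_succ_of \<gamma> \<beta>"
  shows "aorb X \<phi> \<gamma> = aorb_Suc X (sorb X \<phi> \<beta>)"
proof -
  have "\<not> is_zero_ord \<gamma>"
    using assms by (auto simp: is_zero_ord_def is_succ_of_def not_le)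
  then show ?thesis
    using assms by (subst aorb.simps) (auto simp: sorb_def the_is_succ_of)
qed

lemma aorb_limit:
  assumes "\<not> is_zero_ord \<gamma>" "\<nexists>\<beta>. is_succ_of \<gamma> \<beta>"
  shows "aorb X \<phi> \<gamma> x = (\<Union>\<beta>\<in>{..<\<gamma>}. sorb X \<phi> \<beta> x)"
  unfolding sorb_def by (subst aorb.simps) (simp only: assms if_False)

definition lyapunov_stable_of_degree ::
    "'a topology \<Rightarrow> ('a \<Rightarrow> 'a) \<Rightarrow> 'o::wellorder \<Rightarrow> 'a set \<Rightarrow> bool" where
  "lyapunov_stable_of_degree X \<phi> \<alpha> M \<longleftrightarrow>
     M \<subseteq> topspace X \<and>
     M = \<Inter>{orb_closure X (sorb X \<phi> \<alpha>) U |U. U \<in> inv_open_nhds X (sorb X \<phi> \<alpha>) M}"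


section \<open>Ordinals\<close>

text \<open>
  The type \<open>'b ordinal\<close> consists of the ordinals of cardinality at most that of \<open>'b\<close>:
  isomorphism classes of well-orders on subsets of \<open>'b\<close>.
\<close>

quotient_type 'b ordinal = "'b rel" / partial: "\<lambda>r s. (r, s) \<in> ordIso"
proof (rule part_equivpI)
  show "\<exists>r::'b rel. (r, r) \<in> ordIso"
    using ordIso_reflexive[of "{} :: 'b rel"] by auto
  show "symp (\<lambda>r s::'b rel. (r, s) \<in> ordIso)"
    by (auto intro: sympI ordIso_symmetric)
  show "transp (\<lambda>r s::'b rel. (r, s) \<in> ordIso)"
    by (auto intro: transpI ordIso_transitive)
qed

instantiation ordinal :: (type) wellorder
begin

lift_definition less_eq_ordinal :: "'b ordinal \<Rightarrow> 'b ordinal \<Rightarrow> bool" is "\<lambda>r s. (r, s) \<in> ordLeq"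
  by (meson ordIso_ordLeq_trans ordIso_symmetric ordLeq_ordIso_trans)

lift_definition less_ordinal :: "'b ordinal \<Rightarrow> 'b ordinal \<Rightarrow> bool" is "\<lambda>r s. (r, s) \<in> ordLess"
  by (meson ordIso_ordLess_trans ordIso_symmetric ordLess_ordIso_trans)

instance
proof
  have WO: "Well_order r" if "(r, r) \<in> ordIso" for r :: "'b rel"
    using that by (simp add: ordIso_def)
  fix x y z :: "'b ordinal"
  show "x < y \<longleftrightarrow> x \<le> y \<and> \<not> y \<le> x"
    by transfer (meson WO not_ordLeq_iff_ordLess ordLess_imp_ordLeq)
  show "x \<le> x"
    by transfer (simp add: WO ordLeq_reflexive)
  show "x \<le> y \<Longrightarrow> y \<le> z \<Longrightarrow> x \<le> z"
    by transfer (rule ordLeq_transitive)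
  show "x \<le> y \<Longrightarrow> y \<le> x \<Longrightarrow> x = y"
    by transfer (simp add: ordIso_iff_ordLeq)
  show "x \<le> y \<or> y \<le> x"
    by transfer (simp add: WO ordLeq_total)
next
  fix P :: "'b ordinal \<Rightarrow> bool" and a
  assume step: "\<And>x. (\<And>y. y < x \<Longrightarrow> P y) \<Longrightarrow> P x"
  have "(r, r) \<in> ordIso \<Longrightarrow> P (abs_ordinal r)" for r :: "'b rel"
  proof (induction r rule: wf_induct_rule[OF wf_ordLess])
    case (1 r)
    show ?case
    proof (rule step)
      fix y assume y: "y < abs_ordinal r"
      obtain s where s: "(s, s) \<in> ordIso" "y = abs_ordinal s"
        by (induct y rule: ordinal.abs_induct) blast
      have "(s, r) \<in> ordLess"
        using y 1(2) s by (simp add: less_ordinal.abs_eq)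
      then show "P y"
        using 1 s by blast
    qed
  qed
  then show "P a"
    by (induct a rule: ordinal.abs_induct)
qed

end


section \<open>Absolute Lyapunov stability\<close>

text \<open>
  HOL has no type of all ordinals.  The ordinals of cardinality at most that of \<open>'a rel\<close> are
  sufficient, because \<open>sorb\<^sub>\<gamma>\<close> does not change any more beyond some ordinal among them.  The
  theorem \<open>absolutely_lyapunov_stable_imp_degree\<close> below confirms that absolute Lyapunov stability
  as defined here implies stability of degree \<open>\<alpha>\<close> for \<open>\<alpha>\<close> in every well-ordered type.
\<close>

definition absolutely_lyapunov_stable ::
    "'a topology \<Rightarrow> ('a \<Rightarrow> 'a) \<Rightarrow> 'a set \<Rightarrow> bool" where
  "absolutely_lyapunov_stable X \<phi> M \<longleftrightarrow>
     (\<forall>\<alpha> :: 'a rel ordinal. lyapunov_stable_of_degree X \<phi> \<alpha> M)"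


lemma gen_equiv_refl: "x \<in> K \<Longrightarrow> gen_equiv K A x x"
  unfolding gen_equiv_def by (intro exI[of _ 1] exI[of _ "\<lambda>_. x"]) auto

lemma gen_equiv_in: "gen_equiv K A x y \<Longrightarrow> x \<in> K \<and> y \<in> K"
  unfolding gen_equiv_def by force

lemma gen_equiv_step:
  assumes "x \<in> K" "y \<in> K" "A x \<inter> A y \<noteq> {}"
  shows "gen_equiv K A x y"
  unfolding gen_equiv_def
  by (rule exI[of _ 2], rule exI[of _ "\<lambda>i. if i = 1 then x else y"]) (use assms in auto)

lemma gen_equiv_minimal:
  assumes "gen_equiv K A x y" "\<And>x. x \<in> K \<Longrightarrow> R x x"
    and tr: "\<And>x y z. R x y \<Longrightarrow> R y z \<Longrightarrow> R x z"
    and st: "\<And>x y. x \<in> K \<Longrightarrow> y \<in> K \<Longrightarrow> A x \<inter> A y \<noteq> {} \<Longrightarrow> R x y"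
  shows "R x y"
proof -
  obtain k :: nat and z where z: "1 \<le> k" "\<And>i. i \<in> {1..k} \<Longrightarrow> z i \<in> K" "z 1 = x" "z k = y"
    "\<And>i. i \<in> {1..<k} \<Longrightarrow> A (z i) \<inter> A (z (Suc i)) \<noteq> {}"
    using assms(1) unfolding gen_equiv_def by blast
  have "j \<le> k \<Longrightarrow> R x (z j)" if "1 \<le> j" for j
    using that
  proof (induction j rule: nat_induct_at_least)
    case base
    then show ?case using z assms(2) by auto
  next
    case (Suc j)
    have "R (z j) (z (Suc j))"
      using Suc z(2)[of j] z(2)[of "Suc j"] z(5)[of j] by (intro st) auto
    then show ?case using Suc tr by simp
  qed
  then show ?thesis using z by blast
qed

lemma gen_equiv_trans:
  assumes "gen_equiv K A x y" "gen_equiv K A y w"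
  shows "gen_equiv K A x w"
proof -
  have step: "gen_equiv K A x v" if xu: "gen_equiv K A x u" and v: "v \<in> K" "A u \<inter> A v \<noteq> {}" for u v
  proof -
    obtain k :: nat and z where z: "1 \<le> k" "\<And>i. i \<in> {1..k} \<Longrightarrow> z i \<in> K" "z 1 = x" "z k = u"
      "\<And>i. i \<in> {1..<k} \<Longrightarrow> A (z i) \<inter> A (z (Suc i)) \<noteq> {}"
      using xu unfolding gen_equiv_def by blast
    show ?thesis
      unfolding gen_equiv_def
    proof (intro exI conjI ballI)
      show "1 \<le> Suc k" by simp
      show "(z(Suc k := v)) 1 = x" "(z(Suc k := v)) (Suc k) = v" using z by auto
      show "(z(Suc k := v)) i \<in> K" if "i \<in> {1..Suc k}" for i
        using that z(2)[of i] v by (auto simp: le_Suc_eq)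
      show "A ((z(Suc k := v)) i) \<inter> A ((z(Suc k := v)) (Suc i)) \<noteq> {}" if "i \<in> {1..<Suc k}" for i
        using that z(5)[of i] z(4) v by (cases "i = k") auto
    qed
  qed
  have "gen_equiv K A x y \<longrightarrow> gen_equiv K A x w"
    by (rule gen_equiv_minimal[OF assms(2), where R = "\<lambda>u v. gen_equiv K A x u \<longrightarrow> gen_equiv K A x v"])
       (use step in blast)+
  with assms(1) show ?thesis by blast
qed

lemma gen_equiv_sym:
  assumes "gen_equiv K A x y"
  shows "gen_equiv K A y x"
  by (rule gen_equiv_minimal[OF assms, where R = "\<lambda>u v. gen_equiv K A v u"])
     (auto intro: gen_equiv_refl gen_equiv_trans gen_equiv_step)

text \<open>The equation \<open>sorb\<^sub>\<gamma>(x) = [x]\<close>.\<close>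

lemma sorb_of_class:
  assumes "\<And>x. x \<in> K \<Longrightarrow> x \<in> A x" "\<And>x. x \<in> K \<Longrightarrow> A x \<subseteq> K"
  shows "sorb_of K A x = {y. gen_equiv K A y x}"
proof (intro equalityI subsetI)
  fix y assume "y \<in> sorb_of K A x"
  then obtain w where w: "gen_equiv K A w x" "y \<in> A w"
    by (auto simp: sorb_of_def)
  have "w \<in> K" using gen_equiv_in[OF w(1)] by simp
  moreover from this have "y \<in> K" using w(2) assms(2) by auto
  ultimately have "gen_equiv K A y w"
    using w(2) assms(1)[of y] by (intro gen_equiv_step) auto
  then show "y \<in> {y. gen_equiv K A y x}"
    using gen_equiv_trans[OF _ w(1)] by simp
next
  fix y assume "y \<in> {y. gen_equiv K A y x}"
  then have y: "gen_equiv K A y x" by simp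
  then show "y \<in> sorb_of K A x"
    using assms(1)[of y] gen_equiv_in[OF y] unfolding sorb_of_def by auto
qed

lemma sorb_of_idem:
  assumes "\<And>x. x \<in> K \<Longrightarrow> x \<in> A x" "\<And>x. x \<in> K \<Longrightarrow> A x \<subseteq> K"
  shows "sorb_of K (sorb_of K A) = sorb_of K A"
proof
  fix x
  have cls: "sorb_of K A x = {y. gen_equiv K A y x}" for x
    using assms by (rule sorb_of_class)
  have 1: "x \<in> sorb_of K A x" if "x \<in> K" for x
    using that by (simp add: cls gen_equiv_refl)
  have 2: "sorb_of K A x \<subseteq> K" if "x \<in> K" for x
    using gen_equiv_in[of K A] by (auto simp: cls)
  have "gen_equiv K (sorb_of K A) y x \<longleftrightarrow> gen_equiv K A y x" for y
  proof
    assume "gen_equiv K (sorb_of K A) y x"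
    then show "gen_equiv K A y x"
    proof (rule gen_equiv_minimal)
      fix u v assume "sorb_of K A u \<inter> sorb_of K A v \<noteq> {}"
      then obtain w where "gen_equiv K A w u" "gen_equiv K A w v"
        by (auto simp: cls)
      then show "gen_equiv K A u v"
        using gen_equiv_sym gen_equiv_trans by metis
    qed (auto intro: gen_equiv_refl gen_equiv_trans)
  next
    assume yx: "gen_equiv K A y x"
    have "y \<in> K" "x \<in> K" using gen_equiv_in[OF yx] by auto
    moreover have "y \<in> sorb_of K A x" using yx by (simp add: cls)
    ultimately show "gen_equiv K (sorb_of K A) y x"
      using 1[of y] by (intro gen_equiv_step) auto
  qed
  then have "{y. gen_equiv K (sorb_of K A) y x} = sorb_of K A x"
    by (simp only: cls)
  then show "sorb_of K (sorb_of K A) x = sorb_of K A x"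
    using sorb_of_class[OF 1 2, of x] by (simp only:)
qed

lemma aorb_Suc_contains: "insert x (s x) \<subseteq> aorb_Suc X s x"
proof -
  have "insert x (s x) \<subseteq> orb_closure X s U" if "U \<in> inv_open_nhds X s {x}" for U
  proof -
    have "x \<in> U" "U \<subseteq> orb_closure X s U" "(\<Union>y\<in>U. s y) \<subseteq> U"
      using that interior_of_subset[of X U]
      by (auto simp: inv_open_nhds_def nhds_of_def orb_closure_def)
    then show ?thesis by blast
  qed
  then show ?thesis by (auto simp: aorb_Suc_def)
qed

lemma aorb_props:
  fixes \<gamma> :: "'o::wellorder"
  assumes "\<phi> ` topspace X \<subseteq> topspace X" "x \<in> topspace X"
  shows "x \<in> aorb X \<phi> \<gamma> x \<and> aorb X \<phi> \<gamma> x \<subseteq> topspace X"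
  using assms(2)
proof (induction \<gamma> arbitrary: x rule: less_induct)
  case (less \<gamma>)
  define K where "K = topspace X"
  have IH: "x \<in> sorb X \<phi> \<beta> x \<and> sorb X \<phi> \<beta> x \<subseteq> K" if "x \<in> K" "\<beta> < \<gamma>" for x \<beta>
  proof -
    have "sorb X \<phi> \<beta> x = {y. gen_equiv K (aorb X \<phi> \<beta>) y x}"
      unfolding sorb_def K_def by (rule sorb_of_class) (use less.IH that in auto)
    then show ?thesis
      using that(1) gen_equiv_refl[of x K] gen_equiv_in[of K "aorb X \<phi> \<beta>"] by auto
  qed
  have sub: "sorb X \<phi> \<beta> y \<subseteq> K" if "\<beta> < \<gamma>" for y and \<beta> :: 'o
  proof
    fix z assume "z \<in> sorb X \<phi> \<beta> y"
    then obtain w where "gen_equiv K (aorb X \<phi> \<beta>) w y" "z \<in> aorb X \<phi> \<beta> w"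
      by (auto simp: sorb_def sorb_of_def K_def)
    moreover from this have "w \<in> K" using gen_equiv_in by metis
    ultimately show "z \<in> K" using less.IH[OF that, of w] by (auto simp: K_def)
  qed
  have K: "K \<in> nhds_of X {x}"
    using less.prems by (simp add: nhds_of_def K_def)
  consider "is_zero_ord \<gamma>" | \<beta> where "is_succ_of \<gamma> \<beta>" |
    "\<not> is_zero_ord \<gamma>" "\<nexists>\<beta>. is_succ_of \<gamma> \<beta>" by blast
  then show ?case
  proof cases
    case 1
    have "x \<in> aorb_0 X \<phi> x"
      by (auto simp: aorb_0_def nhds_of_def dest: subsetD[OF interior_of_subset])
    moreover have "aorb_0 X \<phi> x \<subseteq> K"
      unfolding aorb_0_def using K assms(1) by (intro Inter_lower) (simp add: K_def)
    ultimately show ?thesis using 1 by (simp add: aorb_zero K_def)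
  next
    case 2
    then have \<beta>: "\<beta> < \<gamma>" by (simp add: is_succ_of_def)
    have "x \<in> aorb_Suc X (sorb X \<phi> \<beta>) x"
      using aorb_Suc_contains by fast
    moreover have "K \<in> inv_open_nhds X (sorb X \<phi> \<beta>) {x}"
      using K sub[OF \<beta>] by (auto simp: inv_open_nhds_def K_def)
    moreover have "orb_closure X (sorb X \<phi> \<beta>) K \<subseteq> K"
      unfolding orb_closure_def using sub[OF \<beta>] by (intro Inter_lower) (auto simp: K_def)
    ultimately show ?thesis using 2 unfolding aorb_succ[OF 2] aorb_Suc_def K_def by blast
  next
    case 3
    obtain \<beta> where "\<beta> < \<gamma>" using 3(1) by (auto simp: is_zero_ord_def not_le)
    then show ?thesis using IH less.prems 3 by (auto simp: aorb_limit K_def)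
  qed
qed

context
  fixes X :: "'a topology" and \<phi> :: "'a \<Rightarrow> 'a"
  assumes \<phi>: "\<phi> ` topspace X \<subseteq> topspace X"
begin

lemma sorb_class: "sorb X \<phi> \<gamma> x = {y. gen_equiv (topspace X) (aorb X \<phi> \<gamma>) y x}"
  unfolding sorb_def by (rule sorb_of_class) (use aorb_props[OF \<phi>] in auto)

lemma sorb_outside: "x \<notin> topspace X \<Longrightarrow> sorb X \<phi> \<gamma> x = {}"
  using gen_equiv_in[of "topspace X" "aorb X \<phi> \<gamma>"] by (auto simp: sorb_class)

lemma aorb_subset_sorb: "x \<in> topspace X \<Longrightarrow> aorb X \<phi> \<gamma> x \<subseteq> sorb X \<phi> \<gamma> x"
  unfolding sorb_def sorb_of_def using gen_equiv_refl[of x "topspace X"] by auto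

lemma sorb_subset_aorb:
  fixes \<beta> \<gamma> :: "'o::wellorder"
  assumes "x \<in> topspace X" "\<beta> < \<gamma>"
  shows "sorb X \<phi> \<beta> x \<subseteq> aorb X \<phi> \<gamma> x"
  using assms(2)
proof (induction \<gamma> rule: less_induct)
  case (less \<gamma>)
  then have nz: "\<not> is_zero_ord \<gamma>" by (auto simp: is_zero_ord_def not_le)
  show ?case
  proof (cases "\<exists>\<delta>. is_succ_of \<gamma> \<delta>")
    case False
    then show ?thesis using nz less.prems by (auto simp: aorb_limit)
  next
    case True
    then obtain \<delta> where \<delta>: "is_succ_of \<gamma> \<delta>" by blast
    then have lt: "\<delta> < \<gamma>" "\<beta> \<le> \<delta>" using less.prems by (auto simp: is_succ_of_def not_less)
    have "sorb X \<phi> \<beta> x \<subseteq> sorb X \<phi> \<delta> x"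
    proof (cases "\<beta> = \<delta>")
      case False
      then show ?thesis
        using less.IH[OF lt(1)] aorb_subset_sorb[OF assms(1), of \<delta>] lt(2) by (auto simp: order_le_less)
    qed simp
    also have "\<dots> \<subseteq> aorb_Suc X (sorb X \<phi> \<delta>) x"
      using aorb_Suc_contains by fast
    finally show ?thesis by (simp add: aorb_succ[OF \<delta>])
  qed
qed

lemma sorb_mono:
  fixes \<beta> \<gamma> :: "'o::wellorder"
  assumes "\<beta> \<le> \<gamma>"
  shows "sorb X \<phi> \<beta> x \<subseteq> sorb X \<phi> \<gamma> x"
proof (cases "x \<in> topspace X \<and> \<beta> \<noteq> \<gamma>")
  case True
  then show ?thesis
    using sorb_subset_aorb[of x \<beta> \<gamma>] aorb_subset_sorb[of x \<gamma>] assms by force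
qed (auto simp: sorb_outside)

lemma sorb_stable:
  fixes \<beta> \<gamma> \<delta> :: "'o::wellorder"
  assumes "\<beta> < \<gamma>" "sorb X \<phi> \<beta> = sorb X \<phi> \<gamma>" "\<beta> \<le> \<delta>"
  shows "sorb X \<phi> \<delta> = sorb X \<phi> \<beta>"
  using assms(3)
proof (induction \<delta> rule: less_induct)
  case (less \<delta>)
  show ?case
  proof (cases "\<beta> = \<delta>")
    case False
    then have lt: "\<beta> < \<delta>" using less.prems by simp
    then have nz: "\<not> is_zero_ord \<delta>" by (auto simp: is_zero_ord_def not_le)
    show ?thesis
    proof (cases "\<exists>\<epsilon>. is_succ_of \<delta> \<epsilon>")
      case True
      then obtain \<epsilon> where \<epsilon>: "is_succ_of \<delta> \<epsilon>" by blast
      then have e: "\<epsilon> < \<delta>" "\<beta> \<le> \<epsilon>" using lt by (auto simp: is_succ_of_def not_less)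
      define \<beta>' where "\<beta>' = (LEAST \<xi>. \<beta> < \<xi>)"
      have b: "\<beta> < \<beta>'" "\<beta>' \<le> \<gamma>"
        unfolding \<beta>'_def using assms(1) by (rule LeastI, rule Least_le)
      have b': "is_succ_of \<beta>' \<beta>"
        unfolding is_succ_of_def using b(1) not_less_Least unfolding \<beta>'_def by blast
      have "aorb X \<phi> \<delta> = aorb X \<phi> \<beta>'"
        using less.IH[OF e] by (simp add: aorb_succ[OF \<epsilon>] aorb_succ[OF b'])
      then have "sorb X \<phi> \<delta> = sorb X \<phi> \<beta>'" by (simp add: sorb_def)
      also have "\<dots> = sorb X \<phi> \<beta>"
      proof
        fix x
        show "sorb X \<phi> \<beta>' x = sorb X \<phi> \<beta> x"
          using sorb_mono[OF b(2), of x] sorb_mono[OF less_imp_le[OF b(1)], of x] assms(2)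
          by simp
      qed
      finally show ?thesis .
    next
      case F: False
      have "aorb X \<phi> \<delta> x = sorb X \<phi> \<beta> x" for x
      proof -
        have "sorb X \<phi> \<epsilon> x \<subseteq> sorb X \<phi> \<beta> x" if "\<epsilon> < \<delta>" for \<epsilon>
          using less.IH[OF that] sorb_mono[of \<epsilon> \<beta> x] by (cases "\<beta> \<le> \<epsilon>") auto
        then show ?thesis using lt nz F by (auto simp: aorb_limit)
      qed
      then have "aorb X \<phi> \<delta> = sorb X \<phi> \<beta>" ..
      then have "sorb X \<phi> \<delta> = sorb_of (topspace X) (sorb X \<phi> \<beta>)"
        by (simp only: sorb_def[of X \<phi> \<delta>])
      also have "\<dots> = sorb X \<phi> \<beta>"
        unfolding sorb_def by (rule sorb_of_idem) (use aorb_props[OF \<phi>] in auto)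
      finally show ?thesis .
    qed
  qed simp
qed

end

text \<open>\<open>aorb\<^sub>\<gamma>\<close> depends only on the order type of \<^term>\<open>{..<\<gamma>}\<close>.\<close>

lemma aorb_embed:
  fixes f :: "'o::wellorder \<Rightarrow> 'p::wellorder"
  assumes f: "\<And>\<gamma>. bij_betw f {..\<gamma>} {..f \<gamma>}"
  shows "aorb X \<phi> (f \<gamma>) = aorb X \<phi> \<gamma>"
proof (induction \<gamma> rule: less_induct)
  case (less \<gamma>)
  have mono: "f \<beta> \<le> f \<gamma>" if "\<beta> \<le> \<gamma>" for \<beta> \<gamma>
    using f[of \<gamma>] that by (auto simp: bij_betw_def)
  have inj: "inj f"
  proof (rule injI)
    fix x y assume "f x = f y"
    then show "x = y"
      using f[of "max x y"] by (auto simp: bij_betw_def inj_on_def)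
  qed
  have less_iff: "f \<beta> < f \<gamma> \<longleftrightarrow> \<beta> < \<gamma>" for \<beta> \<gamma>
    using mono inj by (metis injD leD leI order_le_less)
  have surj: "\<exists>\<beta>. \<delta> = f \<beta> \<and> \<beta> < \<gamma>" if "\<delta> < f \<gamma>" for \<delta> \<gamma>
  proof -
    have "\<delta> \<in> f ` {..\<gamma>}" using f[of \<gamma>] that by (auto simp: bij_betw_def)
    then show ?thesis using that less_iff by blast
  qed
  have img: "f ` {..<\<gamma>} = {..<f \<gamma>}" using surj less_iff by blast
  have zero: "is_zero_ord (f \<gamma>) \<longleftrightarrow> is_zero_ord \<gamma>"
    using surj less_iff unfolding is_zero_ord_def by (metis not_le)
  have succ: "is_succ_of (f \<gamma>) (f \<beta>) \<longleftrightarrow> is_succ_of \<gamma> \<beta>" for \<beta>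
  proof
    show "is_succ_of (f \<gamma>) (f \<beta>)" if "is_succ_of \<gamma> \<beta>"
      unfolding is_succ_of_def
    proof (intro conjI notI)
      show "f \<beta> < f \<gamma>" using that less_iff by (simp add: is_succ_of_def)
      assume "\<exists>\<delta>>f \<beta>. \<delta> < f \<gamma>"
      then obtain \<delta> where "f \<beta> < \<delta>" "\<delta> < f \<gamma>" by blast
      then show False using surj[of \<delta> \<gamma>] that less_iff by (auto simp: is_succ_of_def)
    qed
    show "is_succ_of \<gamma> \<beta>" if "is_succ_of (f \<gamma>) (f \<beta>)"
      using that less_iff unfolding is_succ_of_def by metis
  qed
  have succ': "(\<exists>\<beta>. is_succ_of (f \<gamma>) \<beta>) \<longleftrightarrow> (\<exists>\<beta>. is_succ_of \<gamma> \<beta>)"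
    using surj succ unfolding is_succ_of_def by metis
  have S: "sorb X \<phi> (f \<beta>) = sorb X \<phi> \<beta>" if "\<beta> < \<gamma>" for \<beta>
    using less.IH[OF that] by (simp add: sorb_def)
  consider "is_zero_ord \<gamma>" | \<beta> where "is_succ_of \<gamma> \<beta>" |
    "\<not> is_zero_ord \<gamma>" "\<nexists>\<beta>. is_succ_of \<gamma> \<beta>" by blast
  then show ?case
  proof cases
    case 1
    then show ?thesis by (simp add: aorb_zero zero)
  next
    case 2
    then have fs: "is_succ_of (f \<gamma>) (f \<beta>)" by (simp only: succ)
    have "\<beta> < \<gamma>" using 2 by (simp add: is_succ_of_def)
    then show ?thesis using S by (simp add: aorb_succ[OF 2] aorb_succ[OF fs])
  next
    case 3
    then have "aorb X \<phi> (f \<gamma>) x = (\<Union>\<beta>\<in>f ` {..<\<gamma>}. sorb X \<phi> \<beta> x)" for x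
      unfolding img using zero succ' by (intro aorb_limit) auto
    then show ?thesis using 3 S by (auto simp: aorb_limit)
  qed
qed

lemma Well_order_UNIV: "Well_order {(x::'o::wellorder, y). x \<le> y}" "Field {(x::'o::wellorder, y). x \<le> y} = UNIV"
proof -
  let ?r = "{(x::'o, y). x \<le> y}"
  show F: "Field ?r = UNIV" by (auto simp: Field_def)
  have "?r - Id = {(x, y). x < y}" by auto
  then have "wf (?r - Id)" using wf by simp
  then show "Well_order ?r"
    unfolding well_order_on_def linear_order_on_def partial_order_on_def preorder_on_def F
    by (auto simp: refl_on_def trans_def antisym_def total_on_def)
qed

lemma wellorder_embed_cases:
  obtains (left) f :: "'o::wellorder \<Rightarrow> 'p::wellorder" where "\<And>\<gamma>. bij_betw f {..\<gamma>} {..f \<gamma>}"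
  | (right) g :: "'p::wellorder \<Rightarrow> 'o::wellorder" where "\<And>\<gamma>. bij_betw g {..\<gamma>} {..g \<gamma>}"
proof -
  have under': "under {(x, y). x \<le> y} a = {..a}" for a :: "'p::wellorder"
    by (auto simp: under_def)
  have under'': "under {(x, y). x \<le> y} a = {..a}" for a :: "'o::wellorder"
    by (auto simp: under_def)
  show ?thesis
    using wellorders_totally_ordered[OF Well_order_UNIV(1)[where 'o = 'o] Well_order_UNIV(1)[where 'o = 'p]]
      left right by (auto simp: embed_def Well_order_UNIV(2) under' under'')
qed

lemma abs_ordinal_less:
  assumes "Well_order r" "Well_order s"
  shows "abs_ordinal r < abs_ordinal s \<longleftrightarrow> (r, s) \<in> ordLess"
  using assms by (simp add: less_ordinal.abs_eq ordIso_reflexive)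

lemma no_inj_ordinal: "\<not> inj (f :: 'b ordinal \<Rightarrow> 'b)"
proof
  assume f: "inj f"
  define r0 where "r0 = {(x :: 'b ordinal, y). x \<le> y}"
  define r where "r = dir_image r0 f"
  have r0: "Well_order r0" "Field r0 = UNIV"
    using Well_order_UNIV unfolding r0_def by blast+
  have r: "Well_order r"
    using Well_order_dir_image[OF r0(1)] f unfolding r_def by (simp add: r0)
  have Fr: "f x \<in> Field r" for x
    by (simp add: r_def dir_image_Field r0)
  have under: "underS r (f x) = f ` {..<x}" for x
  proof -
    have le: "(f a, f x) \<in> r \<longleftrightarrow> a \<le> x" for a
      using f unfolding r_def dir_image_def r0_def by (auto simp: inj_eq)
    show ?thesis
    proof (intro equalityI subsetI)
      fix b assume b: "b \<in> underS r (f x)"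
      then obtain a where a: "b = f a"
        by (auto simp: underS_def r_def dir_image_def)
      then have "a \<le> x" "a \<noteq> x"
        using b le[of a] by (auto simp: underS_def)
      then show "b \<in> f ` {..<x}" using a by simp
    next
      fix b assume "b \<in> f ` {..<x}"
      then obtain a where "b = f a" "a < x" by auto
      then show "b \<in> underS r (f x)"
        using le[of a] f by (auto simp: underS_def inj_eq)
    qed
  qed
  define R where "R x = Restr r (underS r (f x))" for x
  have R: "Well_order (R x)" for x
    unfolding R_def by (rule Well_order_Restr[OF r])
  have less: "(R x, r) \<in> ordLess" for x
    unfolding R_def by (rule underS_Restr_ordLess[OF r]) (use Fr in blast)
  have mono: "(R x, R y) \<in> ordLess" if "x < y" for x y
  proof -
    have "wo_rel r" using r by (simp add: wo_rel_def)
    then have "wo_rel.ofilter r (underS r (f y))" "wo_rel.ofilter r (underS r (f x))"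
      by (simp_all add: wo_rel.underS_ofilter)
    moreover have "underS r (f x) \<subset> underS r (f y)"
    proof -
      have "f x \<in> f ` {..<y}" "f x \<notin> f ` {..<x}"
        using that f by (auto dest: injD)
      moreover have "f ` {..<x} \<subseteq> f ` {..<y}"
        using that by auto
      ultimately show ?thesis by (auto simp: under)
    qed
    ultimately show ?thesis
      unfolding R_def using ofilter_subset_ordLess[OF r] by blast
  qed
  define g where "g x = abs_ordinal (R x)" for x
  have "strict_mono g"
    unfolding strict_mono_def g_def using abs_ordinal_less R mono by blast
  have "x \<le> g x" for x
  proof (rule ccontr)
    assume "\<not> x \<le> g x"
    then have "g x < x" by simp
    then show False
    proof (induction x rule: less_induct)
      case (less x)
      then show ?case using \<open>strict_mono g\<close> strict_monoD by blast
    qed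
  qed
  moreover have "g x < abs_ordinal r" for x
    unfolding g_def using abs_ordinal_less R r less by blast
  ultimately show False
    using leD by blast
qed

theorem absolutely_lyapunov_stable_imp_degree:
  fixes \<alpha> :: "'o::wellorder"
  assumes "\<phi> ` topspace X \<subseteq> topspace X" "absolutely_lyapunov_stable X \<phi> M"
  shows "lyapunov_stable_of_degree X \<phi> \<alpha> M"
proof -
  have "\<exists>\<alpha>' :: 'a rel ordinal. sorb X \<phi> \<alpha>' = sorb X \<phi> \<alpha>"
  proof (rule wellorder_embed_cases[where 'o = 'o and 'p = "'a rel ordinal"])
    fix f :: "'o \<Rightarrow> 'a rel ordinal" assume "\<And>\<gamma>. bij_betw f {..\<gamma>} {..f \<gamma>}"
    then have "sorb X \<phi> (f \<alpha>) = sorb X \<phi> \<alpha>"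
      unfolding sorb_def by (simp add: aorb_embed)
    then show ?thesis by blast
  next
    fix g :: "'a rel ordinal \<Rightarrow> 'o" assume g: "\<And>\<gamma>. bij_betw g {..\<gamma>} {..g \<gamma>}"
    then have S: "sorb X \<phi> (g \<gamma>) = sorb X \<phi> \<gamma>" for \<gamma>
      unfolding sorb_def by (simp add: aorb_embed)
    have "\<not> inj (\<lambda>\<gamma> :: 'a rel ordinal. {(x, y). y \<in> sorb X \<phi> \<gamma> x})"
      by (rule no_inj_ordinal)
    then obtain \<beta>0 \<gamma>0 :: "'a rel ordinal" where ne: "\<beta>0 \<noteq> \<gamma>0"
      "{(x, y). y \<in> sorb X \<phi> \<beta>0 x} = {(x, y). y \<in> sorb X \<phi> \<gamma>0 x}"
      unfolding inj_def by blast
    then have "sorb X \<phi> \<beta>0 = sorb X \<phi> \<gamma>0"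
      by (intro ext) (auto simp: set_eq_iff)
    then obtain \<beta> \<gamma> :: "'a rel ordinal" where bg: "\<beta> < \<gamma>" "sorb X \<phi> \<beta> = sorb X \<phi> \<gamma>"
      using ne(1) by (metis linorder_neqE)
    show ?thesis
    proof (cases "\<alpha> \<le> g \<gamma>")
      case True
      then have "\<alpha> \<in> g ` {..\<gamma>}" using g[of \<gamma>] by (auto simp: bij_betw_def)
      then show ?thesis using S by (metis imageE)
    next
      case False
      have "g \<beta> \<in> {..g \<gamma>}" "g \<beta> \<noteq> g \<gamma>"
        using g[of \<gamma>] bg(1) by (auto simp: bij_betw_def inj_on_def)
      then have "g \<beta> < g \<gamma>" by simp
      moreover have "sorb X \<phi> (g \<beta>) = sorb X \<phi> (g \<gamma>)" using S bg(2) by simp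
      ultimately have "sorb X \<phi> \<alpha> = sorb X \<phi> (g \<beta>)"
        using False by (metis sorb_stable[OF assms(1)] less_imp_le less_trans not_le)
      then show ?thesis using S by metis
    qed
  qed
  then obtain \<alpha>' :: "'a rel ordinal" where \<alpha>': "sorb X \<phi> \<alpha>' = sorb X \<phi> \<alpha>" ..
  have "lyapunov_stable_of_degree X \<phi> \<alpha>' M"
    using assms(2) by (simp add: absolutely_lyapunov_stable_def)
  then show ?thesis
    by (simp only: lyapunov_stable_of_degree_def \<alpha>')
qed

end

theory Submission
  imports Defs
begin

text \<open>
  Every function in the fixed space is constant on every superorbit, whatever the degree.  This
  goes by induction on the degree: the sets on which a fixed function \<open>f\<close> stays within \<open>e\<close> of its
  value at \<open>x\<close> are competitors in the intersections that define \<open>aorb\<^sub>\<gamma>(x)\<close>.  The same sets show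
  that \<open>\<Inter>\<^sub>f {y. f y = f x}\<close>, the maximal level set of \<open>x\<close>, is Lyapunov stable of every degree.

  For the converse, the superorbits cannot grow strictly through all ordinals, so they are constant
  from some degree \<open>\<beta>\<close> on.  At this degree the equality \<open>aorb\<^sub>\<beta>\<^sub>+\<^sub>1(x) = sorb\<^sub>\<beta>(x)\<close> says precisely that
  each point of the quotient space \<open>K/\<sim>\<^sub>\<beta>\<close> is the intersection of its closed neighborhoods, i.e. that
  the quotient is Hausdorff.  It is also compact, so Urysohn's lemma gives continuous functions
  that are constant on the classes, hence fixed under the Koopman operator, and that separate
  any two classes.  So the maximal level sets are the superorbits of degree \<open>\<beta>\<close>
  (\<open>fixed_functions_separate_stable_superorbits\<close>).  Finally, a set that is Lyapunov stable of
  degree \<open>\<beta>\<close> is an intersection of \<open>sorb\<^sub>\<beta>\<close>-invariant sets and therefore a union of such superorbits.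
\<close>

section \<open>Level sets\<close>

lemma level_set_iff:
  "level_set X F M \<longleftrightarrow> M \<noteq> {} \<and> M \<subseteq> topspace X \<and> (\<forall>f\<in>F. \<forall>x\<in>M. \<forall>y\<in>M. f x = f y)"
proof -
  have "f constant_on M \<longleftrightarrow> (\<forall>x\<in>M. \<forall>y\<in>M. f x = f y)" for f :: "'a \<Rightarrow> complex"
    unfolding constant_on_def by (cases "M = {}") auto
  then show ?thesis unfolding level_set_def by simp
qed

lemma maximal_level_set_iff:
  "maximal_level_set X F M \<longleftrightarrow>
     (\<exists>x\<in>topspace X. M = {y\<in>topspace X. \<forall>f\<in>F. f y = f x})"
proof
  assume M: "maximal_level_set X F M"
  then have lev: "level_set X F M" and max: "\<And>N. level_set X F N \<Longrightarrow> \<not> M \<subset> N"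
    unfolding maximal_level_set_def by blast+
  obtain x where x: "x \<in> M" "x \<in> topspace X"
    using lev unfolding level_set_iff by blast
  define C where "C = {y\<in>topspace X. \<forall>f\<in>F. f y = f x}"
  have "level_set X F C"
    using x unfolding level_set_iff C_def by auto
  then have "\<not> M \<subset> C" by (rule max)
  moreover have "M \<subseteq> C"
    using lev x unfolding level_set_iff C_def by blast
  ultimately show "\<exists>x\<in>topspace X. M = {y\<in>topspace X. \<forall>f\<in>F. f y = f x}"
    using x unfolding C_def by blast
next
  assume "\<exists>x\<in>topspace X. M = {y\<in>topspace X. \<forall>f\<in>F. f y = f x}"
  then obtain x where x: "x \<in> topspace X" and M: "M = {y\<in>topspace X. \<forall>f\<in>F. f y = f x}"
    by blast
  have "N \<subseteq> M" if N: "level_set X F N" and "M \<subseteq> N" for N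
  proof -
    have "x \<in> N" using that x M by blast
    then show ?thesis using N unfolding level_set_iff M by blast
  qed
  moreover have "level_set X F M"
    using x unfolding M level_set_iff by auto
  ultimately show "maximal_level_set X F M"
    unfolding maximal_level_set_def by blast
qed

lemma partition_on_maximal_level_sets:
  "partition_on (topspace X) {M. maximal_level_set X F M}"
proof (rule partition_onI)
  show "\<Union>{M. maximal_level_set X F M} = topspace X"
    unfolding maximal_level_set_iff by blast
  fix M N
  assume M: "M \<in> {M. maximal_level_set X F M}" and N: "N \<in> {M. maximal_level_set X F M}"
    and "M \<noteq> N"
  obtain x where x: "M = {y\<in>topspace X. \<forall>f\<in>F. f y = f x}"
    using M unfolding maximal_level_set_iff by blast
  obtain z where z: "N = {y\<in>topspace X. \<forall>f\<in>F. f y = f z}"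
    using N unfolding maximal_level_set_iff by blast
  have "M = N" if w: "w \<in> M" "w \<in> N" for w
  proof -
    have "f y = f x \<longleftrightarrow> f y = f z" if "f \<in> F" for f y
    proof -
      have "f w = f x" "f w = f z" using w that unfolding x z by blast+
      then show ?thesis by simp
    qed
    then show ?thesis
      unfolding x z by (intro Collect_cong conj_cong refl ball_cong)
  qed
  then show "disjnt M N" using \<open>M \<noteq> N\<close> unfolding disjnt_def by blast
qed (auto simp: maximal_level_set_iff)


section \<open>Fixed functions are constant on superorbits\<close>

text \<open>
  If \<open>f\<close> is constant along \<open>s\<close>, then the sets \<open>{y. dist (f y) c < e}\<close> are open and \<open>s\<close>-invariant, and
  \<open>{y. dist (f y) c \<le> e}\<close> is a closed \<open>s\<close>-invariant set that contains the \<open>s\<close>-closure of the former.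
\<close>

lemma invariant_function_on_Inter_orb_closure:
  fixes f :: "'a \<Rightarrow> 'b::metric_space"
  assumes f: "continuous_map X euclidean f"
    and inv: "\<And>x y. x \<in> topspace X \<Longrightarrow> y \<in> s x \<Longrightarrow> y \<in> topspace X \<and> f y = f x"
    and M: "M \<subseteq> topspace X" "\<And>x. x \<in> M \<Longrightarrow> f x = c"
    and y: "y \<in> \<Inter>{orb_closure X s U |U. U \<in> inv_open_nhds X s M}"
  shows "f y = c"
proof -
  have "dist (f y) c \<le> e" if e: "e > 0" for e
  proof -
    define U where "U = {y\<in>topspace X. f y \<in> ball c e}"
    define F where "F = {y\<in>topspace X. f y \<in> cball c e}"
    have "openin X U"
      unfolding U_def by (rule openin_continuous_map_preimage[OF f]) auto
    moreover from this have "X interior_of U = U" by (simp add: interior_of_openin)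
    moreover have "M \<subseteq> U" using M e unfolding U_def by auto
    ultimately have "U \<in> inv_open_nhds X s M"
      using inv unfolding inv_open_nhds_def nhds_of_def U_def by auto
    then have "y \<in> orb_closure X s U" using y by blast
    moreover have "closedin X F"
      unfolding F_def by (rule closedin_continuous_map_preimage[OF f]) auto
    then have "orb_closure X s U \<subseteq> F"
      unfolding orb_closure_def by (intro Inter_lower) (use inv in \<open>auto simp: U_def F_def\<close>)
    ultimately show ?thesis by (auto simp: F_def dist_commute)
  qed
  then have "dist (f y) c \<le> 0 + e" if "e > 0" for e using that by simp
  then have "dist (f y) c \<le> 0" by (rule field_le_epsilon)
  then show ?thesis by simp
qed

lemma fix_koopman_iff:
  "f \<in> fix_koopman X \<phi> \<longleftrightarrow>
     f \<in> extensional (topspace X) \<and> continuous_map X euclidean f \<and>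
     (\<forall>x\<in>topspace X. f (\<phi> x) = f x)"
  unfolding fix_koopman_def cont_fun_def koopman_def
  by (auto simp: fun_eq_iff restrict_def extensional_def)

context
  fixes X :: "'a topology" and \<phi> :: "'a \<Rightarrow> 'a"
  assumes \<phi>: "\<phi> ` topspace X \<subseteq> topspace X"
begin

lemma self_in_sorb: "x \<in> topspace X \<Longrightarrow> x \<in> sorb X \<phi> \<gamma> x"
  using sorb_class[OF \<phi>] gen_equiv_refl by (metis mem_Collect_eq)

lemma sorb_subset_topspace: "sorb X \<phi> \<gamma> x \<subseteq> topspace X"
  using sorb_class[OF \<phi>] gen_equiv_in by (metis mem_Collect_eq subsetI)

lemma sorb_eq_iff:
  assumes "x \<in> topspace X" "y \<in> topspace X"
  shows "sorb X \<phi> \<gamma> y = sorb X \<phi> \<gamma> x \<longleftrightarrow> y \<in> sorb X \<phi> \<gamma> x"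
proof
  assume "y \<in> sorb X \<phi> \<gamma> x"
  then have yx: "gen_equiv (topspace X) (aorb X \<phi> \<gamma>) y x"
    by (simp add: sorb_class[OF \<phi>])
  show "sorb X \<phi> \<gamma> y = sorb X \<phi> \<gamma> x"
    unfolding sorb_class[OF \<phi>] using gen_equiv_trans yx gen_equiv_sym[OF yx] by metis
qed (use self_in_sorb assms in blast)

text \<open>The orbit relation is contained in every \<open>\<sim>\<^sub>\<gamma>\<close>, because it already is at degree \<open>0\<close>.\<close>

lemma image_in_sorb:
  fixes \<gamma> :: "'o::wellorder"
  assumes "x \<in> topspace X"
  shows "\<phi> x \<in> sorb X \<phi> \<gamma> x"
proof -
  define z :: 'o where "z = (LEAST \<beta>. True)"
  have z: "z \<le> \<beta>" for \<beta> unfolding z_def by (rule Least_le) simp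
  have "\<phi> x \<in> aorb_0 X \<phi> x"
    by (auto simp: aorb_0_def nhds_of_def dest: subsetD[OF interior_of_subset])
  also have "\<dots> = aorb X \<phi> z x" by (simp add: aorb_zero is_zero_ord_def z)
  also have "\<dots> \<subseteq> sorb X \<phi> \<gamma> x"
    using aorb_subset_sorb[OF \<phi> assms] sorb_mono[OF \<phi> z] by blast
  finally show ?thesis .
qed

lemma fixed_constant_on_aorb_0:
  assumes f: "f \<in> fix_koopman X \<phi>" and x: "x \<in> topspace X" and y: "y \<in> aorb_0 X \<phi> x"
  shows "f y = f x"
proof -
  have cont: "continuous_map X euclidean f" using f by (simp add: fix_koopman_iff)
  have "dist (f y) (f x) \<le> e" if e: "e > 0" for e
  proof -
    define U where "U = {y\<in>topspace X. f y \<in> ball (f x) e}"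
    define F where "F = {y\<in>topspace X. f y \<in> cball (f x) e}"
    have "openin X U"
      unfolding U_def by (rule openin_continuous_map_preimage[OF cont]) auto
    then have "U \<subseteq> X interior_of F"
      by (intro interior_of_maximal) (auto simp: U_def F_def)
    moreover have "x \<in> U" using x e by (simp add: U_def)
    moreover have "closedin X F"
      unfolding F_def by (rule closedin_continuous_map_preimage[OF cont]) auto
    moreover have "\<phi> ` F \<subseteq> F"
      using f \<phi> by (auto simp: F_def fix_koopman_iff)
    moreover have "F \<subseteq> topspace X" by (auto simp: F_def)
    ultimately have "F \<in> {U \<in> nhds_of X {x}. closedin X U \<and> \<phi> ` U \<subseteq> U}"
      unfolding nhds_of_def by simp blast
    then have "y \<in> F" using y unfolding aorb_0_def by (rule InterD[rotated])
    then show ?thesis by (simp add: F_def dist_commute)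
  qed
  then have "dist (f y) (f x) \<le> 0 + e" if "e > 0" for e using that by simp
  then have "dist (f y) (f x) \<le> 0" by (rule field_le_epsilon)
  then show ?thesis by simp
qed

lemma fixed_constant_on_sorb:
  fixes \<gamma> :: "'o::wellorder"
  assumes f: "f \<in> fix_koopman X \<phi>" and "x \<in> topspace X" "y \<in> sorb X \<phi> \<gamma> x"
  shows "f y = f x"
  using assms(2,3)
proof (induction \<gamma> arbitrary: x y rule: less_induct)
  case (less \<gamma>)
  have aorb: "f v = f u" if u: "u \<in> topspace X" and v: "v \<in> aorb X \<phi> \<gamma> u" for u v
  proof -
    consider "is_zero_ord \<gamma>" | \<beta> where "is_succ_of \<gamma> \<beta>" |
      "\<not> is_zero_ord \<gamma>" "\<nexists>\<beta>. is_succ_of \<gamma> \<beta>" by blast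
    then show ?thesis
    proof cases
      case 1
      then show ?thesis using fixed_constant_on_aorb_0[OF f u] v by (simp add: aorb_zero)
    next
      case 2
      then have "\<beta> < \<gamma>" by (simp add: is_succ_of_def)
      show ?thesis
      proof (rule invariant_function_on_Inter_orb_closure[where M = "{u}"])
        show "v \<in> \<Inter>{orb_closure X (sorb X \<phi> \<beta>) U |U. U \<in> inv_open_nhds X (sorb X \<phi> \<beta>) {u}}"
          using v by (simp add: aorb_succ[OF 2] aorb_Suc_def)
      qed (use f u less.IH[OF \<open>\<beta> < \<gamma>\<close>] subsetD[OF sorb_subset_topspace] in \<open>auto simp: fix_koopman_iff\<close>)
    next
      case 3
      then show ?thesis using v u less.IH by (auto simp: aorb_limit)
    qed
  qed
  have "gen_equiv (topspace X) (aorb X \<phi> \<gamma>) y x"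
    using less.prems by (simp add: sorb_class[OF \<phi>])
  then show ?case
  proof (rule gen_equiv_minimal[where R = "\<lambda>u v. f u = f v"])
    fix u v assume "u \<in> topspace X" "v \<in> topspace X" "aorb X \<phi> \<gamma> u \<inter> aorb X \<phi> \<gamma> v \<noteq> {}"
    then show "f u = f v" using aorb by (metis disjoint_iff)
  qed simp_all
qed

lemma maximal_level_set_lyapunov_stable:
  fixes \<alpha> :: "'o::wellorder"
  assumes M: "maximal_level_set X (fix_koopman X \<phi>) M"
  shows "lyapunov_stable_of_degree X \<phi> \<alpha> M"
proof -
  let ?I = "\<Inter>{orb_closure X (sorb X \<phi> \<alpha>) U |U. U \<in> inv_open_nhds X (sorb X \<phi> \<alpha>) M}"
  obtain x where x: "x \<in> topspace X"
    and Meq: "M = {y\<in>topspace X. \<forall>f\<in>fix_koopman X \<phi>. f y = f x}"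
    using M unfolding maximal_level_set_iff by blast
  have "?I \<subseteq> M"
  proof
    fix y assume y: "y \<in> ?I"
    have "f y = f x" if "f \<in> fix_koopman X \<phi>" for f
      by (rule invariant_function_on_Inter_orb_closure[OF _ _ _ _ y])
         (use that fixed_constant_on_sorb[OF that] subsetD[OF sorb_subset_topspace] Meq
           in \<open>auto simp: fix_koopman_iff\<close>)
    moreover have "y \<in> topspace X"
    proof -
      have "topspace X \<in> inv_open_nhds X (sorb X \<phi> \<alpha>) M"
        using sorb_subset_topspace Meq by (auto simp: inv_open_nhds_def nhds_of_def)
      moreover have "orb_closure X (sorb X \<phi> \<alpha>) (topspace X) \<subseteq> topspace X"
        unfolding orb_closure_def using sorb_subset_topspace by (intro Inter_lower) auto
      ultimately show ?thesis using y by blast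
    qed
    ultimately show "y \<in> M" unfolding Meq by blast
  qed
  moreover have "M \<subseteq> ?I"
  proof (rule Inter_greatest)
    fix C assume "C \<in> {orb_closure X (sorb X \<phi> \<alpha>) U |U. U \<in> inv_open_nhds X (sorb X \<phi> \<alpha>) M}"
    then obtain U where U: "U \<in> inv_open_nhds X (sorb X \<phi> \<alpha>) M"
      and C: "C = orb_closure X (sorb X \<phi> \<alpha>) U" by blast
    have "M \<subseteq> U"
      using U interior_of_subset[of X U] by (auto simp: inv_open_nhds_def nhds_of_def)
    moreover have "U \<subseteq> C" unfolding C orb_closure_def by blast
    ultimately show "M \<subseteq> C" by blast
  qed
  moreover have "M \<subseteq> topspace X" unfolding Meq by blast
  ultimately show ?thesis
    unfolding lyapunov_stable_of_degree_def by simp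
qed

text \<open>
  Closed sets that occur in an \<open>s\<close>-closure are \<open>s\<close>-invariant, and invariance passes to intersections.
\<close>

lemma lyapunov_stable_sorb_invariant:
  assumes "lyapunov_stable_of_degree X \<phi> \<alpha> N" "x \<in> N"
  shows "sorb X \<phi> \<alpha> x \<subseteq> N"
proof -
  have inv: "sorb X \<phi> \<alpha> x \<subseteq> orb_closure X (sorb X \<phi> \<alpha>) U"
    if "x \<in> orb_closure X (sorb X \<phi> \<alpha>) U" for U
    using that unfolding orb_closure_def by blast
  have N: "N = \<Inter>{orb_closure X (sorb X \<phi> \<alpha>) U |U. U \<in> inv_open_nhds X (sorb X \<phi> \<alpha>) N}"
    using assms(1) unfolding lyapunov_stable_of_degree_def by blast
  show ?thesis
    by (subst N) (use inv assms(2) N in blast)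
qed

end


section \<open>Stabilization of the superorbits\<close>

text \<open>
  There are more ordinals in \<open>'a rel ordinal\<close> than relations on \<open>'a\<close>, so two of the relations
  \<open>\<sim>\<^sub>\<gamma>\<close> coincide, and then so do all those in between.
\<close>

lemma superorbits_stabilize:
  assumes \<phi>: "\<phi> ` topspace X \<subseteq> topspace X"
  obtains \<beta> \<gamma> :: "'a rel ordinal"
  where "is_succ_of \<gamma> \<beta>" "sorb X \<phi> \<gamma> = (sorb X \<phi> \<beta> :: 'a \<Rightarrow> 'a set)"
proof -
  have "\<not> inj (\<lambda>\<gamma> :: 'a rel ordinal. {(x, y). y \<in> sorb X \<phi> \<gamma> x})"
    by (rule no_inj_ordinal)
  then obtain \<beta>0 \<gamma>0 :: "'a rel ordinal" where ne: "\<beta>0 \<noteq> \<gamma>0"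
    "{(x, y). y \<in> sorb X \<phi> \<beta>0 x} = {(x, y). y \<in> sorb X \<phi> \<gamma>0 x}"
    unfolding inj_def by blast
  then have "sorb X \<phi> \<beta>0 = sorb X \<phi> \<gamma>0"
    by (intro ext) (auto simp: set_eq_iff)
  then obtain \<beta> \<delta> :: "'a rel ordinal" where bd: "\<beta> < \<delta>" "sorb X \<phi> \<beta> = sorb X \<phi> \<delta>"
    using ne(1) by (metis linorder_neqE)
  define \<gamma> where "\<gamma> = (LEAST \<xi>. \<beta> < \<xi>)"
  have "\<beta> < \<gamma>" unfolding \<gamma>_def using bd(1) by (rule LeastI)
  then have "is_succ_of \<gamma> \<beta>"
    unfolding is_succ_of_def using not_less_Least unfolding \<gamma>_def by blast
  moreover have "sorb X \<phi> \<gamma> = sorb X \<phi> \<beta>"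
    by (rule sorb_stable[OF \<phi> bd less_imp_le[OF \<open>\<beta> < \<gamma>\<close>]])
  ultimately show thesis using that by blast
qed


section \<open>Separation by fixed functions\<close>

text \<open>
  Urysohn's lemma in the quotient of a compact space by the fibres of \<open>q\<close>; the separation
  hypothesis says that this quotient is Hausdorff.
\<close>

lemma Urysohn_saturated:
  fixes q :: "'a \<Rightarrow> 'b"
  assumes X: "compact_space X"
    and sep: "\<And>x y. \<lbrakk>x \<in> topspace X; y \<in> topspace X; q x \<noteq> q y\<rbrakk> \<Longrightarrow>
      \<exists>V W. openin X {z\<in>topspace X. q z \<in> V} \<and> openin X {z\<in>topspace X. q z \<in> W} \<and>
        q x \<in> V \<and> q y \<in> W \<and> disjnt V W"
    and xy: "x \<in> topspace X" "y \<in> topspace X" "q x \<noteq> q y"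
  obtains f :: "'b \<Rightarrow> real" where "continuous_map X euclideanreal (f \<circ> q)" "f (q x) = 0" "f (q y) = 1"
proof -
  define pre where "pre V = {z\<in>topspace X. q z \<in> V}" for V
  define Y where "Y = topology (\<lambda>V. V \<subseteq> q ` topspace X \<and> openin X (pre V))"
  have "istopology (\<lambda>V. V \<subseteq> q ` topspace X \<and> openin X (pre V))"
    unfolding istopology_def
  proof (intro conjI allI impI)
    fix V W assume "V \<subseteq> q ` topspace X \<and> openin X (pre V)" "W \<subseteq> q ` topspace X \<and> openin X (pre W)"
    moreover have "pre (V \<inter> W) = pre V \<inter> pre W" by (auto simp: pre_def)
    ultimately show "V \<inter> W \<subseteq> q ` topspace X" "openin X (pre (V \<inter> W))" by auto
  next
    fix \<V> assume "\<forall>V\<in>\<V>. V \<subseteq> q ` topspace X \<and> openin X (pre V)"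
    moreover have "pre (\<Union>\<V>) = \<Union>(pre ` \<V>)" by (auto simp: pre_def)
    ultimately show "\<Union>\<V> \<subseteq> q ` topspace X" "openin X (pre (\<Union>\<V>))" by auto
  qed
  then have openY: "openin Y V \<longleftrightarrow> V \<subseteq> q ` topspace X \<and> openin X (pre V)" for V
    unfolding Y_def by simp
  have "pre (q ` topspace X) = topspace X" by (auto simp: pre_def)
  then have topY: "topspace Y = q ` topspace X"
    using openY by (metis openin_subset openin_topspace order_refl subset_antisym)
  then have q: "quotient_map X Y q"
    unfolding quotient_map_def openY pre_def by auto
  have "compactin Y (q ` topspace X)"
    by (rule image_compactin[OF X[unfolded compact_space_def] quotient_imp_continuous_map[OF q]])
  then have "compact_space Y" by (simp add: compact_space_def topY)
  moreover have haus: "Hausdorff_space Y"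
    unfolding Hausdorff_space_def topY
  proof clarify
    fix u v assume "u \<in> topspace X" "v \<in> topspace X" "q u \<noteq> q v"
    then obtain V W where VW: "openin X (pre V)" "openin X (pre W)" "q u \<in> V" "q v \<in> W" "disjnt V W"
      using sep unfolding pre_def by meson
    let ?R = "\<lambda>V. V \<inter> q ` topspace X"
    have "pre (?R V) = pre V" for V by (auto simp: pre_def)
    then have "openin Y (?R V)" "openin Y (?R W)" using VW by (auto simp: openY)
    moreover have "q u \<in> ?R V" "q v \<in> ?R W" "disjnt (?R V) (?R W)"
      using VW \<open>u \<in> _\<close> \<open>v \<in> _\<close> by (auto simp: disjnt_def)
    ultimately show "\<exists>V W. openin Y V \<and> openin Y W \<and> q u \<in> V \<and> q v \<in> W \<and> disjnt V W"
      by blast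
  qed
  ultimately have "normal_space Y"
    using compact_Hausdorff_or_regular_imp_normal_space by blast
  moreover have "closedin Y {q x}" "closedin Y {q y}"
    using closedin_Hausdorff_singleton[OF haus] xy topY by auto
  ultimately obtain f :: "'b \<Rightarrow> real"
    where f: "continuous_map Y euclideanreal f" "f ` {q x} \<subseteq> {0}" "f ` {q y} \<subseteq> {1}"
    using xy(3) unfolding normal_space_iff_Urysohn_alt by (metis disjnt_insert1 disjnt_empty1 singletonD)
  show thesis
    by (rule that[OF continuous_map_compose[OF quotient_imp_continuous_map[OF q] f(1)]]) (use f in auto)
qed

text \<open>
  Stabilization turns the definition of \<open>aorb\<^sub>\<beta>\<^sub>+\<^sub>1(x)\<close> into the Hausdorff property of \<open>K/\<sim>\<^sub>\<beta>\<close>: a point \<open>y\<close>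
  outside the superorbit of \<open>x\<close> avoids some closed invariant set \<open>F\<close> around an open
  invariant neighborhood of \<open>x\<close>, and the complement of \<open>F\<close> is again invariant.
\<close>

lemma fixed_functions_separate_stable_superorbits:
  fixes \<beta> \<gamma> :: "'o::wellorder"
  assumes X: "compact_space X" and \<phi>: "\<phi> ` topspace X \<subseteq> topspace X"
    and succ: "is_succ_of \<gamma> \<beta>" and stab: "sorb X \<phi> \<gamma> = sorb X \<phi> \<beta>"
    and xy: "x \<in> topspace X" "y \<in> topspace X" "y \<notin> sorb X \<phi> \<beta> x"
  obtains f where "f \<in> fix_koopman X \<phi>" "f x \<noteq> f y"
proof -
  define S where "S = sorb X \<phi> \<beta>"
  have eq: "S v = S u \<longleftrightarrow> v \<in> S u" if "u \<in> topspace X" "v \<in> topspace X" for u v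
    unfolding S_def by (rule sorb_eq_iff[OF \<phi> that])
  have self: "u \<in> S u" if "u \<in> topspace X" for u
    unfolding S_def by (rule self_in_sorb[OF \<phi> that])
  have sub: "S u \<subseteq> topspace X" for u
    unfolding S_def by (rule sorb_subset_topspace[OF \<phi>])
  have pre: "{z\<in>topspace X. S z \<in> S ` U} = U"
    if "U \<subseteq> topspace X" "\<And>u. u \<in> U \<Longrightarrow> S u \<subseteq> U" for U
  proof -
    have "z \<in> U" if "z \<in> topspace X" "u \<in> U" "S z = S u" for z u
      using that self[of z] \<open>\<And>u. u \<in> U \<Longrightarrow> S u \<subseteq> U\<close>[of u] by blast
    then show ?thesis using that by blast
  qed
  have sep: "\<exists>V W. openin X {z\<in>topspace X. S z \<in> V} \<and> openin X {z\<in>topspace X. S z \<in> W} \<and>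
      S u \<in> V \<and> S v \<in> W \<and> disjnt V W"
    if uv: "u \<in> topspace X" "v \<in> topspace X" "S u \<noteq> S v" for u v
  proof -
    have "v \<notin> S u" using eq uv by metis
    then have "v \<notin> aorb_Suc X S u"
      using aorb_subset_sorb[OF \<phi> uv(1), of \<gamma>] stab unfolding S_def aorb_succ[OF succ] by auto
    then obtain U F where U: "U \<in> inv_open_nhds X S {u}"
      and F: "closedin X F" "U \<subseteq> F" "(\<Union>y\<in>F. S y) \<subseteq> F" "v \<notin> F"
      unfolding aorb_Suc_def orb_closure_def by blast
    let ?W = "topspace X - F"
    have Uo: "openin X U" "(\<Union>y\<in>U. S y) \<subseteq> U" and u: "u \<in> U"
      using U interior_of_subset[of X U] by (auto simp: inv_open_nhds_def nhds_of_def)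
    have Wo: "openin X ?W" using F(1) by blast
    have W_inv: "S w \<subseteq> ?W" if w: "w \<in> ?W" for w
    proof
      fix z assume z: "z \<in> S w"
      then have "z \<in> topspace X" using sub by blast
      \<comment> \<open>Here symmetry enters: if \<open>z\<close> were in \<open>F\<close>, then so would be \<open>w\<close>, a member of its class.\<close>
      then have "w \<in> S z" using z w eq by (metis DiffD1)
      then show "z \<in> ?W" using w F(3) \<open>z \<in> topspace X\<close> by blast
    qed
    have "disjnt (S ` U) (S ` ?W)"
    proof -
      have "S a \<noteq> S b" if "a \<in> U" "b \<in> ?W" for a b
        using that self[of b] Uo(2) F(2) by blast
      then show ?thesis unfolding disjnt_def by blast
    qed
    moreover have "{z\<in>topspace X. S z \<in> S ` U} = U"
      by (rule pre) (use Uo openin_subset in blast)+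
    moreover have "{z\<in>topspace X. S z \<in> S ` ?W} = ?W"
      by (rule pre) (use W_inv in blast)+
    ultimately show ?thesis
      using Uo(1) Wo u uv(2) F(4) by (intro exI[of _ "S ` U"] exI[of _ "S ` ?W"]) auto
  qed
  have "S x \<noteq> S y" using eq[OF xy(1,2)] xy(3) unfolding S_def by metis
  then obtain g :: "'a set \<Rightarrow> real"
    where g: "continuous_map X euclideanreal (g \<circ> S)" "g (S x) = 0" "g (S y) = 1"
    using Urysohn_saturated[OF X sep xy(1,2)] by blast
  define f where "f = restrict (\<lambda>z. complex_of_real (g (S z))) (topspace X)"
  have "continuous_map X euclidean (complex_of_real \<circ> (g \<circ> S))"
    by (rule continuous_map_compose[OF g(1)]) (simp add: continuous_on_of_real_id)
  then have "continuous_map X euclidean f"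
    by (rule continuous_map_eq) (simp add: f_def)
  moreover have "f (\<phi> z) = f z" if "z \<in> topspace X" for z
  proof -
    have "\<phi> z \<in> topspace X" using \<phi> that by blast
    moreover have "\<phi> z \<in> S z" unfolding S_def by (rule image_in_sorb[OF \<phi> that])
    ultimately have "S (\<phi> z) = S z" using eq that by blast
    then show ?thesis using \<open>\<phi> z \<in> topspace X\<close> that by (simp add: f_def)
  qed
  ultimately have "f \<in> fix_koopman X \<phi>" by (simp add: fix_koopman_iff f_def)
  moreover have "f x \<noteq> f y" using g xy by (simp add: f_def)
  ultimately show thesis by (rule that)
qed


section \<open>The finest decomposition into absolutely Lyapunov stable sets\<close>

theorem theorem5p6:
  fixes X :: "'a topology" and \<phi> :: "'a \<Rightarrow> 'a"
  assumes "compact_space X" "Hausdorff_space X"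
    and "continuous_map X X \<phi>"
  shows "partition_on (topspace X) {M. maximal_level_set X (fix_koopman X \<phi>) M}
    \<and> (\<forall>M. maximal_level_set X (fix_koopman X \<phi>) M \<longrightarrow> absolutely_lyapunov_stable X \<phi> M)
    \<and> (\<forall>P. partition_on (topspace X) P \<and> (\<forall>N\<in>P. absolutely_lyapunov_stable X \<phi> N)
         \<longrightarrow> (\<forall>M. maximal_level_set X (fix_koopman X \<phi>) M \<longrightarrow> (\<exists>N\<in>P. M \<subseteq> N)))"
proof (intro conjI allI impI)
  have \<phi>: "\<phi> ` topspace X \<subseteq> topspace X"
    using assms(3) by (rule continuous_map_image_subset_topspace)
  show "partition_on (topspace X) {M. maximal_level_set X (fix_koopman X \<phi>) M}"
    by (rule partition_on_maximal_level_sets)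
  show "absolutely_lyapunov_stable X \<phi> M" if "maximal_level_set X (fix_koopman X \<phi>) M" for M
    unfolding absolutely_lyapunov_stable_def
    using maximal_level_set_lyapunov_stable[OF \<phi> that] by blast
  fix P M
  assume P: "partition_on (topspace X) P \<and> (\<forall>N\<in>P. absolutely_lyapunov_stable X \<phi> N)"
    and "maximal_level_set X (fix_koopman X \<phi>) M"
  then obtain x where x: "x \<in> topspace X"
    and M: "M = {y\<in>topspace X. \<forall>f\<in>fix_koopman X \<phi>. f y = f x}"
    unfolding maximal_level_set_iff by blast
  obtain \<beta> \<gamma> :: "'a rel ordinal" where stab: "is_succ_of \<gamma> \<beta>" "sorb X \<phi> \<gamma> = sorb X \<phi> \<beta>"
    using superorbits_stabilize[OF \<phi>] by blast
  have "M \<subseteq> sorb X \<phi> \<beta> x"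
  proof
    fix y assume "y \<in> M"
    then have y: "y \<in> topspace X" "\<And>f. f \<in> fix_koopman X \<phi> \<Longrightarrow> f y = f x"
      unfolding M by auto
    show "y \<in> sorb X \<phi> \<beta> x"
    proof (rule ccontr)
      assume "y \<notin> sorb X \<phi> \<beta> x"
      from fixed_functions_separate_stable_superorbits[OF assms(1) \<phi> stab x y(1) this]
      obtain f where f: "f \<in> fix_koopman X \<phi>" "f x \<noteq> f y" .
      then show False using y(2)[OF f(1)] by simp
    qed
  qed
  moreover obtain N where N: "N \<in> P" "x \<in> N"
    using P x unfolding partition_on_def by blast
  moreover have "lyapunov_stable_of_degree X \<phi> \<beta> N"
    using P N(1) unfolding absolutely_lyapunov_stable_def by blast
  ultimately show "\<exists>N\<in>P. M \<subseteq> N"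
    using lyapunov_stable_sorb_invariant[OF \<phi>] by blast
qed

end
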